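(* Let $S$ be a spider with legs $L_1,L_2,\ldots,L_s$, and let $\ell_i=|E(L_i)|$ for each $i\in[1,s]$. Suppose that $\ell_{i+1}\geq 2\ell_i+2$ for every $i\in[2,s-1]$, and that $\ell_2\geq 2\ell_1+2$ if $\ell_2\not\equiv 1 \pmod 4$ and $\ell_2\geq 2\ell_1+4$ otherwise. Then $S$ is graceful.
   Context: For integers $p,q$, $[p,q]=\{i\in\mathbb{Z}: p\le i\le q\}$. A graceful labeling of a graph $G$ is an injective function $f:V(G)\to[0,|E(G)|]$ such that $\{|f(x)-f(y)| : xy\in E(G)\}=[1,|E(G)|]$; $G$ is graceful if it admits one. A spider is a tree with at most one vertex of degree greater than two; when such a vertex exists it is the center, and each path in the spider joining the center to a leaf is called a leg. A leg's length is its number of edges. *)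

theory Defs
  imports Main
begin

text \<open>
  Finite simple undirected graphs are given by a vertex set and a set of two-element edges.
  The predicate \<open>tree\<close> of the AFP entry Graph Theory is not usable here: undirected graphs are
  modelled there as symmetric digraphs, and each pair of opposite arcs already counts as a cycle.
\<close>

definition simple_graph :: "'a set \<Rightarrow> 'a set set \<Rightarrow> bool" where
  "simple_graph V E \<longleftrightarrow> finite V \<and> (\<forall>e\<in>E. e \<subseteq> V \<and> card e = 2)"

definition vertex_degree :: "'a set set \<Rightarrow> 'a \<Rightarrow> nat" where
  "vertex_degree E v = card {e \<in> E. v \<in> e}"

definition is_path :: "'a set \<Rightarrow> 'a set set \<Rightarrow> 'a list \<Rightarrow> bool" where
  "is_path V E p \<longleftrightarrow> p \<noteq> [] \<and> set p \<subseteq> V \<and> distinct p \<and> successively (\<lambda>x y. {x, y} \<in> E) p"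

definition path_edges :: "'a list \<Rightarrow> 'a set set" where
  "path_edges p = {{p ! i, p ! Suc i} | i. Suc i < length p}"

definition is_cycle :: "'a set \<Rightarrow> 'a set set \<Rightarrow> 'a list \<Rightarrow> bool" where
  "is_cycle V E p \<longleftrightarrow> is_path V E p \<and> length p \<ge> 3 \<and> {last p, hd p} \<in> E"

definition connected_graph :: "'a set \<Rightarrow> 'a set set \<Rightarrow> bool" where
  "connected_graph V E \<longleftrightarrow>
     V \<noteq> {} \<and> (\<forall>u\<in>V. \<forall>v\<in>V. \<exists>p. is_path V E p \<and> hd p = u \<and> last p = v)"

definition is_tree :: "'a set \<Rightarrow> 'a set set \<Rightarrow> bool" where
  "is_tree V E \<longleftrightarrow> simple_graph V E \<and> connected_graph V E \<and> (\<nexists>p. is_cycle V E p)"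

definition spider :: "'a set \<Rightarrow> 'a set set \<Rightarrow> bool" where
  "spider V E \<longleftrightarrow> is_tree V E \<and>
     (\<forall>u\<in>V. \<forall>v\<in>V. vertex_degree E u > 2 \<and> vertex_degree E v > 2 \<longrightarrow> u = v)"

definition is_center :: "'a set \<Rightarrow> 'a set set \<Rightarrow> 'a \<Rightarrow> bool" where
  "is_center V E c \<longleftrightarrow> c \<in> V \<and> vertex_degree E c > 2"

definition is_leaf :: "'a set \<Rightarrow> 'a set set \<Rightarrow> 'a \<Rightarrow> bool" where
  "is_leaf V E v \<longleftrightarrow> v \<in> V \<and> vertex_degree E v = 1"

text \<open>
  A leg is listed from the center outwards, so that each leg, as a subgraph, is represented by
  exactly one vertex list. A spider without a center (a path graph) has no legs.
\<close>

definition legs :: "'a set \<Rightarrow> 'a set set \<Rightarrow> 'a list set" where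
  "legs V E = {p. is_path V E p \<and> is_center V E (hd p) \<and> is_leaf V E (last p)}"

definition graceful_labeling :: "'a set \<Rightarrow> 'a set set \<Rightarrow> ('a \<Rightarrow> int) \<Rightarrow> bool" where
  "graceful_labeling V E f \<longleftrightarrow>
     inj_on f V \<and> f ` V \<subseteq> {0..int (card E)} \<and>
     {\<bar>f x - f y\<bar> | x y. {x, y} \<in> E} = {1..int (card E)}"

definition graceful :: "'a set \<Rightarrow> 'a set set \<Rightarrow> bool" where
  "graceful V E \<longleftrightarrow> (\<exists>f. graceful_labeling V E f)"

end

theory Submission
  imports Defs
begin

text \<open>
  The spider even has an \<open>\<alpha>\<close>-labeling. Index each of the two colour classes outwards from the gap
  between low and high labels; then a labeling is an \<open>\<alpha>\<close>-labeling iff the sums of the indices of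
  adjacent vertices are exactly \<open>0, \<dots>, n - 1\<close>, and reversing both indexings is a symmetry.
  Let \<open>u\<close> and \<open>v\<close> be the numbers of vertices in the class of the center on its two sides. A new leg
  with \<open>m\<close> vertices can be placed outside all old indices if some \<open>\<alpha>\<close>-labeled path with \<open>m\<close> vertices
  starts at index \<open>v\<close>, and by symmetry inside all of them if one starts at \<open>u\<close>. By Rosa's theorem this
  works whenever the index is less than \<open>m / 2\<close> and, if positive, different from \<open>(m - 1) / 4\<close>.
  Adding the legs by increasing length, \<open>u + v\<close> is always less than the last length \<open>\<ell>\<close>, whereas
  \<open>m \<ge> 2 * \<ell> + 2\<close>; so both sides are short enough, and they cannot both be equal to \<open>(m - 1) / 4\<close>.
\<close>

section \<open>Paths with alternating low and high labels\<close>

text \<open>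
  \<open>w\<close> lists the indices along a path with \<open>m\<close> vertices; the vertices at even and at odd positions
  form the two colour classes, and each class is indexed from \<open>0\<close> separately.
\<close>

definition alpha_path :: "nat \<Rightarrow> (nat \<Rightarrow> nat) \<Rightarrow> bool" where
  "alpha_path m w \<longleftrightarrow>
     (\<forall>i<m. even i \<longrightarrow> w i < (m + 1) div 2) \<and> (\<forall>x<(m + 1) div 2. \<exists>i<m. even i \<and> w i = x) \<and>
     (\<forall>i<m. odd i \<longrightarrow> w i < m div 2) \<and> (\<forall>x<m div 2. \<exists>i<m. odd i \<and> w i = x) \<and>
     (\<forall>i. Suc i < m \<longrightarrow> w i + w (Suc i) < m - 1) \<and>
     (\<forall>k<m - 1. \<exists>i. Suc i < m \<and> w i + w (Suc i) = k)"

section \<open>Reversal of alternating paths and prepending of zigzags\<close>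

text \<open>The largest indices of the two classes add up to \<open>m - 2\<close>, so reversing both
  indexings turns an edge sum \<open>t\<close> into \<open>m - 2 - t\<close> and permutes the
  required sums. A start at \<open>j\<close> is traded for a start at
  \<open>(m + 1) div 2 - 1 - j\<close>.\<close>

lemma alpha_path_reverse:
  assumes "alpha_path m w"
  shows "alpha_path m (\<lambda>i. if even i then (m + 1) div 2 - 1 - w i else m div 2 - 1 - w i)"
    (is "alpha_path m ?r")
proof -
  have ev: "\<And>i. i < m \<Longrightarrow> even i \<Longrightarrow> w i < (m + 1) div 2"
    and ev_onto: "\<And>x. x < (m + 1) div 2 \<Longrightarrow> \<exists>i<m. even i \<and> w i = x"
    and od: "\<And>i. i < m \<Longrightarrow> odd i \<Longrightarrow> w i < m div 2"
    and od_onto: "\<And>x. x < m div 2 \<Longrightarrow> \<exists>i<m. odd i \<and> w i = x"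
    and sm: "\<And>i. Suc i < m \<Longrightarrow> w i + w (Suc i) < m - 1"
    and sm_onto: "\<And>k. k < m - 1 \<Longrightarrow> \<exists>i. Suc i < m \<and> w i + w (Suc i) = k"
    using assms unfolding alpha_path_def by blast+
  have halves: "(m + 1) div 2 + m div 2 = m" by presburger
  have sums: "?r i + ?r (Suc i) = m - 2 - (w i + w (Suc i))" if "Suc i < m" for i
  proof (cases "even i")
    case True
    then show ?thesis using ev[of i] od[of "Suc i"] that halves by simp
  next
    case False
    then show ?thesis using od[of i] ev[of "Suc i"] that halves by simp
  qed
  have "\<exists>i<m. even i \<and> ?r i = x" if "x < (m + 1) div 2" for x
    using ev_onto[of "(m + 1) div 2 - 1 - x"] that by force
  moreover have "\<exists>i<m. odd i \<and> ?r i = x" if "x < m div 2" for x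
    using od_onto[of "m div 2 - 1 - x"] that by force
  moreover have "\<exists>i. Suc i < m \<and> ?r i + ?r (Suc i) = k" if k: "k < m - 1" for k
  proof -
    have "m - 2 - k < m - 1" using k by linarith
    then obtain i where "Suc i < m" "w i + w (Suc i) = m - 2 - k" using sm_onto by blast
    moreover have "m - 2 - (m - 2 - k) = k" using k by linarith
    ultimately show ?thesis using sums[of i] by (intro exI[of _ i]) simp
  qed
  moreover have "?r i + ?r (Suc i) < m - 1" if "Suc i < m" for i
    unfolding sums[OF that] using that by linarith
  moreover have "?r i < (m + 1) div 2" if "i < m" "even i" for i
    using that ev[of i] by simp
  moreover have "?r i < m div 2" if "i < m" "odd i" for i
    using that od[of i] by simp
  ultimately show ?thesis unfolding alpha_path_def by blast
qed

text \<open>The prefix \<open>c, c, c-1, c-1, ..., 0, 0\<close> uses the indices up to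
  \<open>c\<close> in both classes and has the sums \<open>2 * c, ..., 0\<close>. The linking edge
  has sum \<open>0 + (w 0 + c + 1) = 2 * c + 1\<close>, which is where \<open>w 0 = c\<close>
  enters. The rest keeps its parities and its sums rise by \<open>2 * c + 2\<close>.\<close>

lemma alpha_path_zigzag_even:
  fixes c r :: nat and w :: "nat \<Rightarrow> nat"
  assumes "alpha_path r w" and "w 0 = c" and "0 < r"
  shows "alpha_path (2 * c + 2 + r)
           (\<lambda>i. if i < 2 * c + 2 then c - i div 2 else w (i - (2 * c + 2)) + (c + 1))"
    (is "alpha_path ?m ?z")
proof -
  define z where "z = ?z"
  have ev: "\<And>i. i < r \<Longrightarrow> even i \<Longrightarrow> w i < (r + 1) div 2"
    and ev_onto: "\<And>x. x < (r + 1) div 2 \<Longrightarrow> \<exists>i<r. even i \<and> w i = x"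
    and od: "\<And>i. i < r \<Longrightarrow> odd i \<Longrightarrow> w i < r div 2"
    and od_onto: "\<And>x. x < r div 2 \<Longrightarrow> \<exists>i<r. odd i \<and> w i = x"
    and sm: "\<And>i. Suc i < r \<Longrightarrow> w i + w (Suc i) < r - 1"
    and sm_onto: "\<And>k. k < r - 1 \<Longrightarrow> \<exists>i. Suc i < r \<and> w i + w (Suc i) = k"
    using assms(1) unfolding alpha_path_def by blast+
  have halves: "(?m + 1) div 2 = c + 1 + (r + 1) div 2" "?m div 2 = c + 1 + r div 2"
    by presburger+
  have inner: "z i + z (Suc i) = 2 * c - i" if "i \<le> 2 * c" for i
    using that unfolding z_def by (auto; presburger)
  have link: "z (2 * c + 1) + z (Suc (2 * c + 1)) = 2 * c + 1"
    using assms(2) by (simp add: z_def)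
  have outer: "z (2 * c + 2 + i) = w i + (c + 1)" for i by (simp add: z_def)
  have "z i < (?m + 1) div 2" if "i < ?m" "even i" for i
  proof (cases "i < 2 * c + 2")
    case False
    with that have "w (i - (2 * c + 2)) < (r + 1) div 2" by (intro ev) auto
    with False show ?thesis unfolding halves by (simp add: z_def)
  qed (unfold halves, simp add: z_def)
  moreover have "z i < ?m div 2" if "i < ?m" "odd i" for i
  proof (cases "i < 2 * c + 2")
    case False
    with that have "w (i - (2 * c + 2)) < r div 2" by (intro od) auto
    with False show ?thesis unfolding halves by (simp add: z_def)
  qed (unfold halves, simp add: z_def)
  moreover have "\<exists>i<?m. even i \<and> z i = x" if "x < (?m + 1) div 2" for x
  proof (cases "x \<le> c")
    case True
    then show ?thesis by (intro exI[of _ "2 * (c - x)"]) (auto simp: z_def)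
  next
    case False
    with that halves have "x - (c + 1) < (r + 1) div 2" by linarith
    then obtain i where "i < r" "even i" "w i = x - (c + 1)" using ev_onto by blast
    with False show ?thesis using outer[of i] by (intro exI[of _ "2 * c + 2 + i"]) simp
  qed
  moreover have "\<exists>i<?m. odd i \<and> z i = x" if "x < ?m div 2" for x
  proof (cases "x \<le> c")
    case True
    then show ?thesis by (intro exI[of _ "2 * (c - x) + 1"]) (auto simp: z_def)
  next
    case False
    with that halves have "x - (c + 1) < r div 2" by linarith
    then obtain i where "i < r" "odd i" "w i = x - (c + 1)" using od_onto by blast
    with False show ?thesis using outer[of i] by (intro exI[of _ "2 * c + 2 + i"]) simp
  qed
  moreover have "z i + z (Suc i) < ?m - 1" if "Suc i < ?m" for i
  proof -
    consider "i \<le> 2 * c" | "i = 2 * c + 1" | "2 * c + 2 \<le> i" by linarith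
    then show ?thesis
    proof cases
      case 1
      then show ?thesis using inner[of i] by linarith
    next
      case 2
      then show ?thesis using link assms(3) by simp
    next
      case 3
      then obtain j where "i = 2 * c + 2 + j" using le_Suc_ex by blast
      then show ?thesis using sm[of j] that outer[of j] outer[of "Suc j"] by simp
    qed
  qed
  moreover have "\<exists>i. Suc i < ?m \<and> z i + z (Suc i) = k" if "k < ?m - 1" for k
  proof -
    consider "k \<le> 2 * c" | "k = 2 * c + 1" | "2 * c + 2 \<le> k" by linarith
    then show ?thesis
    proof cases
      case 1
      then show ?thesis using inner[of "2 * c - k"] by (intro exI[of _ "2 * c - k"]) simp
    next
      case 2
      then show ?thesis using link assms(3) by (intro exI[of _ "2 * c + 1"]) simp
    next
      case 3
      then obtain j where j: "k = 2 * c + 2 + j" using le_Suc_ex by blast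
      with that have "j < r - 1" by linarith
      then obtain i where "Suc i < r" "w i + w (Suc i) = j" using sm_onto by blast
      then show ?thesis using j outer[of i] outer[of "Suc i"]
        by (intro exI[of _ "2 * c + 2 + i"]) simp
    qed
  qed
  ultimately have "alpha_path ?m z" unfolding alpha_path_def by blast
  then show ?thesis unfolding z_def .
qed

text \<open>Here the prefix is \<open>c, c-1, c-1, ..., 0, 0\<close>, with \<open>c + 1\<close>
  vertices at even and \<open>c\<close> at odd positions and the sums
  \<open>2 * c - 1, ..., 0\<close>. Its odd length swaps the two classes of the rest, so the shift
  depends on the parity of the position; sums rise by \<open>2 * c + 1\<close>, and the linking edge
  fills the gap at \<open>2 * c\<close>.\<close>

lemma alpha_path_zigzag_odd:
  fixes c r :: nat and w :: "nat \<Rightarrow> nat"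
  assumes "alpha_path r w" and "w 0 = c" and "0 < r"
  shows "alpha_path (2 * c + 1 + r)
           (\<lambda>i. if i < 2 * c + 1 then c - (i + 1) div 2
                else w (i - (2 * c + 1)) + (if even i then c + 1 else c))"
    (is "alpha_path ?m ?z")
proof -
  define z where "z = ?z"
  have ev: "\<And>i. i < r \<Longrightarrow> even i \<Longrightarrow> w i < (r + 1) div 2"
    and ev_onto: "\<And>x. x < (r + 1) div 2 \<Longrightarrow> \<exists>i<r. even i \<and> w i = x"
    and od: "\<And>i. i < r \<Longrightarrow> odd i \<Longrightarrow> w i < r div 2"
    and od_onto: "\<And>x. x < r div 2 \<Longrightarrow> \<exists>i<r. odd i \<and> w i = x"
    and sm: "\<And>i. Suc i < r \<Longrightarrow> w i + w (Suc i) < r - 1"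
    and sm_onto: "\<And>k. k < r - 1 \<Longrightarrow> \<exists>i. Suc i < r \<and> w i + w (Suc i) = k"
    using assms(1) unfolding alpha_path_def by blast+
  have halves: "(?m + 1) div 2 = c + 1 + r div 2" "?m div 2 = c + (r + 1) div 2"
    by presburger+
  have inner: "z i + z (Suc i) = 2 * c - 1 - i" if "i < 2 * c" for i
    using that unfolding z_def by (auto; presburger)
  have link: "z (2 * c) + z (Suc (2 * c)) = 2 * c"
    using assms(2) by (simp add: z_def)
  have outer: "z (2 * c + 1 + i) = w i + (if even i then c else c + 1)" for i by (simp add: z_def)
  have "z i < (?m + 1) div 2" if "i < ?m" "even i" for i
  proof (cases "i < 2 * c + 1")
    case False
    with that have "w (i - (2 * c + 1)) < r div 2" by (intro od) auto
    with False that show ?thesis unfolding halves by (simp add: z_def)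
  qed (unfold halves, simp add: z_def)
  moreover have "z i < ?m div 2" if "i < ?m" "odd i" for i
  proof (cases "i < 2 * c + 1")
    case True
    with that have "c > 0" by (cases "c = 0") auto
    moreover have "(i + 1) div 2 > 0" using that by presburger
    ultimately show ?thesis using True unfolding halves by (simp add: z_def)
  next
    case False
    with that have "w (i - (2 * c + 1)) < (r + 1) div 2" by (intro ev) auto
    with False that show ?thesis unfolding halves by (simp add: z_def)
  qed
  moreover have "\<exists>i<?m. even i \<and> z i = x" if "x < (?m + 1) div 2" for x
  proof (cases "x \<le> c")
    case True
    then show ?thesis by (intro exI[of _ "2 * (c - x)"]) (auto simp: z_def)
  next
    case False
    with that halves have "x - (c + 1) < r div 2" by linarith
    then obtain i where "i < r" "odd i" "w i = x - (c + 1)" using od_onto by blast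
    with False show ?thesis using outer[of i] by (intro exI[of _ "2 * c + 1 + i"]) simp
  qed
  moreover have "\<exists>i<?m. odd i \<and> z i = x" if "x < ?m div 2" for x
  proof (cases "x < c")
    case True
    then show ?thesis by (intro exI[of _ "2 * (c - x) - 1"]) (auto simp: z_def)
  next
    case False
    with that halves have "x - c < (r + 1) div 2" by linarith
    then obtain i where "i < r" "even i" "w i = x - c" using ev_onto by blast
    with False show ?thesis using outer[of i] by (intro exI[of _ "2 * c + 1 + i"]) simp
  qed
  moreover have "z i + z (Suc i) < ?m - 1" if "Suc i < ?m" for i
  proof -
    consider "i < 2 * c" | "i = 2 * c" | "2 * c + 1 \<le> i" by linarith
    then show ?thesis
    proof cases
      case 1
      then show ?thesis using inner[of i] by linarith
    next
      case 2
      then show ?thesis using link assms(3) by simp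
    next
      case 3
      then obtain j where "i = 2 * c + 1 + j" using le_Suc_ex by blast
      then show ?thesis using sm[of j] that outer[of j] outer[of "Suc j"] by (auto split: if_splits)
    qed
  qed
  moreover have "\<exists>i. Suc i < ?m \<and> z i + z (Suc i) = k" if "k < ?m - 1" for k
  proof -
    consider "k < 2 * c" | "k = 2 * c" | "2 * c + 1 \<le> k" by linarith
    then show ?thesis
    proof cases
      case 1
      then show ?thesis using inner[of "2 * c - 1 - k"] by (intro exI[of _ "2 * c - 1 - k"]) simp
    next
      case 2
      then show ?thesis using link assms(3) by (intro exI[of _ "2 * c"]) simp
    next
      case 3
      then obtain j where j: "k = 2 * c + 1 + j" using le_Suc_ex by blast
      with that have "j < r - 1" by linarith
      then obtain i where "Suc i < r" "w i + w (Suc i) = j" using sm_onto by blast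
      then show ?thesis using j outer[of i] outer[of "Suc i"]
        by (intro exI[of _ "2 * c + 1 + i"]) auto
    qed
  qed
  ultimately have "alpha_path ?m z" unfolding alpha_path_def by blast
  then show ?thesis unfolding z_def .
qed

text \<open>
  This is Rosa's theorem on snakes. For \<open>m \<ge> 4 * j + 2\<close> one splits off an initial zigzag with
  \<open>2 * j + 1\<close> or \<open>2 * j + 2\<close> vertices; the rest has to start at \<open>j\<close> again. The remaining cases follow
  by reversal. The case \<open>m = 4 * j + 1\<close> is excluded because the sum of all edge sums would force both
  ends of the path, which lie in the same class, to have index \<open>j\<close>.
\<close>

lemma alpha_path_exists:
  assumes "j < (m + 1) div 2" and "j = 0 \<or> m \<noteq> 4 * j + 1"
  shows "\<exists>w. alpha_path m w \<and> w 0 = j"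
  using assms
proof (induction m arbitrary: j rule: less_induct)
  case (less m)
  have long: "\<exists>w. alpha_path m w \<and> w 0 = j"
    if "4 * j + 2 \<le> m" for j
  proof -
    \<comment> \<open>The even prefix is the default. For \<open>m = 4 * j + 2\<close> it would
      leave \<open>2 * j\<close> vertices, too few for a start at \<open>j\<close>; for
      \<open>m = 6 * j + 3\<close> it would leave \<open>4 * j + 1\<close>, the exceptional length
      when \<open>j > 0\<close>. One more vertex in the rest repairs both.\<close>
    consider "m = 4 * j + 2 \<or> m = 6 * j + 3" | "m \<noteq> 4 * j + 2" "m \<noteq> 6 * j + 3" by blast
    then show ?thesis
    proof cases
      case 1
      define r where "r = m - (2 * j + 1)"
      have r: "m = 2 * j + 1 + r" "0 < r" "r < m" "j < (r + 1) div 2" "j = 0 \<or> r \<noteq> 4 * j + 1"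
        using that 1 unfolding r_def by auto
      then obtain w where w: "alpha_path r w" "w 0 = j" using less.IH by blast
      from alpha_path_zigzag_odd[OF w r(2)] show ?thesis
        unfolding r(1)[symmetric] by - (rule exI, rule conjI, assumption, simp)
    next
      case 2
      define r where "r = m - (2 * j + 2)"
      have r: "m = 2 * j + 2 + r" "0 < r" "r < m" "j < (r + 1) div 2" "j = 0 \<or> r \<noteq> 4 * j + 1"
        using that 2 unfolding r_def by auto
      then obtain w where w: "alpha_path r w" "w 0 = j" using less.IH by blast
      from alpha_path_zigzag_even[OF w r(2)] show ?thesis
        unfolding r(1)[symmetric] by - (rule exI, rule conjI, assumption, simp)
    qed
  qed
  consider "m = 1" "j = 0" | "4 * j + 2 \<le> m" | "m \<le> 4 * j" "j > 0"
    using less.prems by fastforce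
  then show ?case
  proof cases
    case 1
    then show ?thesis by (intro exI[of _ "\<lambda>_. 0"]) (auto simp: alpha_path_def)
  next
    case 2
    then show ?thesis by (rule long)
  next
    case 3
    \<comment> \<open>The image of \<open>j\<close> under reversal; \<open>m \<le> 4 * j\<close>
      makes it small enough for \<open>long\<close>.\<close>
    define k where "k = (m + 1) div 2 - 1 - j"
    have k: "4 * k + 2 \<le> m" "(m + 1) div 2 - 1 - k = j"
      using less.prems(1) 3 unfolding k_def by linarith+
    then obtain w where w: "alpha_path m w" "w 0 = k" using long by blast
    from alpha_path_reverse[OF w(1)] show ?thesis
      by - (rule exI, rule conjI, assumption, simp only: w(2) even_zero if_True k(2))
  qed
qed

section \<open>Attaching a leg\<close>

text \<open>
  \<open>X\<close> and \<open>V - X\<close> are the colour classes, indexed by \<open>h\<close> outwards from the gap between the low and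
  the high labels: a vertex of \<open>X\<close> gets the label \<open>a - 1 - h x\<close>, a vertex of \<open>V - X\<close> the label
  \<open>a + h y\<close>, so an edge has difference \<open>h x + h y + 1\<close>.
\<close>

definition alpha_labeling ::
    "'a set \<Rightarrow> 'a set set \<Rightarrow> 'a set \<Rightarrow> ('a \<Rightarrow> nat) \<Rightarrow> nat \<Rightarrow> nat \<Rightarrow> bool" where
  "alpha_labeling V E X h a b \<longleftrightarrow>
     finite E \<and> card E + 1 = a + b \<and> X \<subseteq> V \<and>
     bij_betw h X {..<a} \<and> bij_betw h (V - X) {..<b} \<and>
     (\<forall>e\<in>E. \<exists>x\<in>X. \<exists>y\<in>V - X. e = {x, y} \<and> h x + h y < card E) \<and>
     (\<forall>k<card E. \<exists>x\<in>X. \<exists>y\<in>V - X. {x, y} \<in> E \<and> h x + h y = k)"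

text \<open>
  \<open>u\<close> and \<open>v\<close> count the vertices in the class of \<open>c\<close> on either side of \<open>c\<close>.
\<close>

definition alpha_labeled :: "'a set \<Rightarrow> 'a set set \<Rightarrow> 'a \<Rightarrow> nat \<Rightarrow> nat \<Rightarrow> bool" where
  "alpha_labeled V E c u v \<longleftrightarrow>
     (\<exists>X h b. alpha_labeling V E X h (u + v + 1) b \<and> c \<in> X \<and> h c = u)"

section \<open>Base case, symmetry and gracefulness of labeled graphs\<close>

lemma alpha_labeled_singleton: "alpha_labeled {c} {} c 0 0"
  unfolding alpha_labeled_def alpha_labeling_def
  by (intro exI[of _ "{c}"] exI[of _ "\<lambda>_. 0"] exI[of _ 0]) (auto simp: bij_betw_def)

lemma bij_betw_reverse_lessThan:
  assumes "bij_betw h A {..<n}"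
  shows "bij_betw (\<lambda>x. n - 1 - h x) A {..<n::nat}"
proof -
  have "bij_betw (\<lambda>i. n - 1 - i) {..<n} {..<n}"
    by (rule bij_betw_byWitness[where f' = "\<lambda>i. n - 1 - i"]) auto
  from bij_betw_trans[OF assms this] show ?thesis by (simp add: comp_def)
qed

text \<open>Reversing both indexings turns an edge sum \<open>t\<close> into
  \<open>u + v + b - 1 - t\<close> and moves \<open>c\<close> from index \<open>u\<close> to index
  \<open>v\<close> among the \<open>u + v + 1\<close> indices of its class.\<close>

lemma alpha_labeled_swap:
  assumes "alpha_labeled V E c u v"
  shows "alpha_labeled V E c v u"
proof -
  obtain X h b where lab: "alpha_labeling V E X h (u + v + 1) b" and c: "c \<in> X" "h c = u"
    using assms unfolding alpha_labeled_def by blast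
  have E: "finite E" "card E = u + v + b" and X: "X \<subseteq> V"
    and bX: "bij_betw h X {..<u + v + 1}" and bY: "bij_betw h (V - X) {..<b}"
    using lab unfolding alpha_labeling_def by simp_all
  have edge: "\<exists>x\<in>X. \<exists>y\<in>V - X. e = {x, y} \<and> h x + h y < u + v + b" if "e \<in> E" for e
    using lab that unfolding alpha_labeling_def E(2) by blast
  have onto: "\<exists>x\<in>X. \<exists>y\<in>V - X. {x, y} \<in> E \<and> h x + h y = k" if "k < u + v + b" for k
    using lab that unfolding alpha_labeling_def E(2) by blast
  define g where "g x = (if x \<in> X then u + v + 1 - 1 - h x else b - 1 - h x)" for x
  have gX: "bij_betw g X {..<v + u + 1}"
    using bij_betw_reverse_lessThan[OF bX]
    by (subst bij_betw_cong[where g = "\<lambda>x. u + v + 1 - 1 - h x"]) (auto simp: g_def add.commute)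
  have gY: "bij_betw g (V - X) {..<b}"
    using bij_betw_reverse_lessThan[OF bY]
    by (subst bij_betw_cong[where g = "\<lambda>x. b - 1 - h x"]) (auto simp: g_def)
  have lt: "h x < u + v + 1" if "x \<in> X" for x using bij_betwE[OF bX] that by auto
  have lt': "h y < b" if "y \<in> V - X" for y using bij_betwE[OF bY] that by auto
  have sum: "g x + g y = u + v + b - 1 - (h x + h y)" if "x \<in> X" "y \<in> V - X" for x y
    using lt[of x] lt'[of y] that by (simp add: g_def)
  have "\<exists>x\<in>X. \<exists>y\<in>V - X. e = {x, y} \<and> g x + g y < v + u + b" if e: "e \<in> E" for e
  proof -
    obtain x y where "x \<in> X" "y \<in> V - X" "e = {x, y}" "h x + h y < u + v + b"
      using edge[OF e] by blast
    moreover from this have "g x + g y < v + u + b" using sum[of x y] by linarith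
    ultimately show ?thesis by blast
  qed
  moreover have "\<exists>x\<in>X. \<exists>y\<in>V - X. {x, y} \<in> E \<and> g x + g y = k" if "k < v + u + b" for k
  proof -
    have "u + v + b - 1 - k < u + v + b" using that by linarith
    then obtain x y where "x \<in> X" "y \<in> V - X" "{x, y} \<in> E" "h x + h y = u + v + b - 1 - k"
      using onto by blast
    moreover from this have "g x + g y = k" using sum[of x y] that by linarith
    ultimately show ?thesis by blast
  qed
  moreover have "g c = v" using c by (simp add: g_def)
  ultimately show ?thesis
    unfolding alpha_labeled_def alpha_labeling_def using E X c gX gY
    by (intro exI[of _ X] exI[of _ g] exI[of _ b]) (simp add: add.commute)
qed

text \<open>The classes receive the disjoint label ranges \<open>0..u + v\<close> and
  \<open>u + v + 1..card E\<close>, and an edge with index sum \<open>k\<close> gets the difference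
  \<open>k + 1\<close>.\<close>

lemma alpha_labeled_imp_graceful:
  assumes "alpha_labeled V E c u v"
  shows "graceful V E"
proof -
  obtain X h b where lab: "alpha_labeling V E X h (u + v + 1) b" and c: "c \<in> X" "h c = u"
    using assms unfolding alpha_labeled_def by blast
  have E: "finite E" "card E = u + v + b" and X: "X \<subseteq> V"
    and bX: "bij_betw h X {..<u + v + 1}" and bY: "bij_betw h (V - X) {..<b}"
    using lab unfolding alpha_labeling_def by simp_all
  have edge: "\<exists>x\<in>X. \<exists>y\<in>V - X. e = {x, y} \<and> h x + h y < u + v + b" if "e \<in> E" for e
    using lab that unfolding alpha_labeling_def E(2) by blast
  have onto: "\<exists>x\<in>X. \<exists>y\<in>V - X. {x, y} \<in> E \<and> h x + h y = k" if "k < u + v + b" for k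
    using lab that unfolding alpha_labeling_def E(2) by blast
  define f where "f x = (if x \<in> X then int (u + v) - int (h x) else int (u + v + 1) + int (h x))" for x
  have lt: "h x \<le> u + v" if "x \<in> X" for x using bij_betwE[OF bX] that by force
  have lt': "h y < b" if "y \<in> V" "y \<notin> X" for y using bij_betwE[OF bY] that by auto
  have diff: "\<bar>f x - f y\<bar> = int (h x + h y) + 1" "\<bar>f y - f x\<bar> = int (h x + h y) + 1"
    if "x \<in> X" "y \<in> V - X" for x y
    using lt[of x] that by (auto simp: f_def)
  have "inj_on f V"
  proof (rule inj_onI)
    fix x y assume xy: "x \<in> V" "y \<in> V" "f x = f y"
    then have "x \<in> X \<longleftrightarrow> y \<in> X" by (auto simp: f_def split: if_splits)
    moreover from this xy(3) have "h x = h y" by (auto simp: f_def split: if_splits)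
    ultimately show "x = y"
      using xy bij_betw_imp_inj_on[OF bX] bij_betw_imp_inj_on[OF bY]
      by (cases "x \<in> X") (auto dest: inj_onD)
  qed
  moreover have "f ` V \<subseteq> {0..int (card E)}"
    using lt lt' by (fastforce simp: f_def E(2))
  moreover have "{\<bar>f x - f y\<bar> | x y. {x, y} \<in> E} = {1..int (card E)}" (is "?D = _")
  proof (intro equalityI subsetI)
    fix d assume "d \<in> ?D"
    then obtain p q where pq: "d = \<bar>f p - f q\<bar>" "{p, q} \<in> E" by blast
    then obtain x y where xy: "x \<in> X" "y \<in> V - X" "{p, q} = {x, y}" "h x + h y < u + v + b"
      using edge by metis
    then have "p = x \<and> q = y \<or> p = y \<and> q = x" by (auto simp: doubleton_eq_iff)
    then have "d = int (h x + h y) + 1" using diff xy pq(1) by metis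
    then show "d \<in> {1..int (card E)}" using xy(4) E(2) by simp
  next
    fix d assume d: "d \<in> {1..int (card E)}"
    then have "nat (d - 1) < u + v + b" using E(2) by auto
    then obtain x y where "x \<in> X" "y \<in> V - X" "{x, y} \<in> E" "h x + h y = nat (d - 1)"
      using onto by blast
    moreover from this have "\<bar>f x - f y\<bar> = d" using diff(1)[of x y] d by auto
    ultimately show "d \<in> ?D" by blast
  qed
  ultimately show ?thesis unfolding graceful_def graceful_labeling_def by blast
qed

section \<open>Transfer of an alternating path to a leg\<close>

lemma card_path_edges:
  assumes "distinct p"
  shows "finite (path_edges p)" and "card (path_edges p) = length p - 1"
proof -
  have img: "path_edges p = (\<lambda>i. {p ! i, p ! Suc i}) ` {..<length p - 1}"
    unfolding path_edges_def by (auto simp: less_diff_conv)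
  have "inj_on (\<lambda>i. {p ! i, p ! Suc i}) {..<length p - 1}"
    using assms by (auto simp: inj_on_def doubleton_eq_iff nth_eq_iff_index_eq less_diff_conv)
  then show "card (path_edges p) = length p - 1" unfolding img by (simp add: card_image)
  show "finite (path_edges p)" unfolding img by simp
qed

lemma card_even_odd_below:
  "card {i. i < m \<and> even i} = (m + 1) div 2" "card {i. i < m \<and> odd i} = m div 2"
proof -
  have "{i. i < m \<and> even i} = (\<lambda>i. 2 * i) ` {..<(m + 1) div 2}" by (auto elim!: evenE)
  then show "card {i. i < m \<and> even i} = (m + 1) div 2"
    by (simp add: card_image inj_on_def)
  have "{i. i < m \<and> odd i} = (\<lambda>i. 2 * i + 1) ` {..<m div 2}" by (auto elim!: oddE)
  then show "card {i. i < m \<and> odd i} = m div 2"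
    by (simp add: card_image inj_on_def)
qed

text \<open>Injectivity follows by counting: each image is as large as its set of positions.\<close>

lemma alpha_path_bij_betw:
  assumes "alpha_path m w"
  shows "bij_betw w {i. i < m \<and> even i} {..<(m + 1) div 2}"
    and "bij_betw w {i. i < m \<and> odd i} {..<m div 2}"
proof -
  have "w ` {i. i < m \<and> even i} = {..<(m + 1) div 2}" "w ` {i. i < m \<and> odd i} = {..<m div 2}"
    using assms unfolding alpha_path_def image_def by blast+
  then show "bij_betw w {i. i < m \<and> even i} {..<(m + 1) div 2}"
    and "bij_betw w {i. i < m \<and> odd i} {..<m div 2}"
    unfolding bij_betw_def by (auto intro!: eq_card_imp_inj_on simp: card_even_odd_below)
qed

text \<open>The neighbour \<open>p ! 0\<close> of \<open>c\<close> lies in the class opposite to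
  \<open>c\<close>. Hence even positions of \<open>p\<close> extend \<open>V - X\<close> with
  indices from \<open>b\<close> on, and odd positions extend \<open>X\<close> with indices from
  \<open>u + v + 1\<close> on. All new vertices of the class of \<open>c\<close> lie beyond
  \<open>c\<close> on the same side, which turns \<open>v\<close> into
  \<open>v + length p div 2\<close>.\<close>

lemma alpha_labeled_attach_path:
  assumes "alpha_labeled V E c u v"
    and p: "distinct p" "p \<noteq> []" "set p \<inter> V = {}"
    and EV: "\<And>e. e \<in> E \<Longrightarrow> e \<subseteq> V"
    and v: "v < (length p + 1) div 2" "v = 0 \<or> length p \<noteq> 4 * v + 1"
  shows "alpha_labeled (V \<union> set p) (E \<union> path_edges (c # p)) c u (v + length p div 2)"
proof -
  define m where "m = length p"
  obtain X h b where lab: "alpha_labeling V E X h (u + v + 1) b" and c: "c \<in> X" "h c = u"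
    using assms(1) unfolding alpha_labeled_def by blast
  have E: "finite E" "card E = u + v + b" and X: "X \<subseteq> V"
    and bX: "bij_betw h X {..<u + v + 1}" and bY: "bij_betw h (V - X) {..<b}"
    using lab unfolding alpha_labeling_def by simp_all
  have edge: "\<exists>x\<in>X. \<exists>y\<in>V - X. e = {x, y} \<and> h x + h y < u + v + b" if "e \<in> E" for e
    using lab that unfolding alpha_labeling_def E(2) by blast
  have onto: "\<exists>x\<in>X. \<exists>y\<in>V - X. {x, y} \<in> E \<and> h x + h y = k" if "k < u + v + b" for k
    using lab that unfolding alpha_labeling_def E(2) by blast
  obtain w where w: "alpha_path m w" "w 0 = v" using alpha_path_exists[OF v] m_def by blast
  have m0: "0 < m" using p(2) m_def by simp
  define a where "a = u + v + 1"
  \<comment> \<open>The position of a vertex on \<open>p\<close>, which lets the new indexing be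
    defined on vertices.\<close>
  define idx where "idx = the_inv_into {..<m} ((!) p)"
  have idx: "idx (p ! i) = i" if "i < m" for i
    unfolding idx_def using that p(1) m_def
    by (intro the_inv_into_f_f) (auto simp: inj_on_def nth_eq_iff_index_eq)
  have notV: "p ! i \<notin> V" if "i < m" for i using p(3) that m_def nth_mem[of i p] by blast
  define g where "g x = (if x \<in> V then h x else w (idx x) + (if even (idx x) then b else a))" for x
  have gp: "g (p ! i) = w i + (if even i then b else a)" if "i < m" for i
    using idx notV that by (simp add: g_def)
  have gV: "g x = h x" if "x \<in> V" for x using that by (simp add: g_def)
  define Od where "Od = (!) p ` {i. i < m \<and> odd i}"
  define Ev where "Ev = (!) p ` {i. i < m \<and> even i}"
  have inj_p: "inj_on ((!) p) I" if "I \<subseteq> {..<m}" for I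
    using that p(1) m_def by (auto simp: inj_on_def nth_eq_iff_index_eq subset_iff)
  have shift: "bij_betw (\<lambda>i. i + k) {..<n} {k..<k + n}" for k n :: nat
    by (rule bij_betw_byWitness[where f' = "\<lambda>i. i - k"]) auto
  \<comment> \<open>Bijectivity is shown on positions first and then carried over to vertices along
    the injective map \<open>(!) p\<close>.\<close>
  have "bij_betw (g \<circ> (!) p) {i. i < m \<and> odd i} {a..<a + m div 2}"
    using bij_betw_trans[OF alpha_path_bij_betw(2)[OF w(1)] shift[of a "m div 2"]]
    by (subst bij_betw_cong[where g = "(\<lambda>i. i + a) \<circ> w"]) (auto simp: gp)
  then have gOd: "bij_betw g Od {a..<a + m div 2}"
    using bij_betw_comp_iff[OF inj_on_imp_bij_betw[OF inj_p]]
    unfolding Od_def by (metis (no_types, lifting) lessThan_iff mem_Collect_eq subsetI)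
  have "bij_betw (g \<circ> (!) p) {i. i < m \<and> even i} {b..<b + (m + 1) div 2}"
    using bij_betw_trans[OF alpha_path_bij_betw(1)[OF w(1)] shift[of b "(m + 1) div 2"]]
    by (subst bij_betw_cong[where g = "(\<lambda>i. i + b) \<circ> w"]) (auto simp: gp)
  then have gE: "bij_betw g Ev {b..<b + (m + 1) div 2}"
    using bij_betw_comp_iff[OF inj_on_imp_bij_betw[OF inj_p]]
    unfolding Ev_def by (metis (no_types, lifting) lessThan_iff mem_Collect_eq subsetI)
  have "bij_betw g X {..<a}"
    using bX X gV by (subst bij_betw_cong[where g = h]) (auto simp: a_def)
  from bij_betw_combine[OF this gOd]
  have gX': "bij_betw g (X \<union> Od) {..<a + m div 2}"
    by (simp add: ivl_disj_un ivl_disj_int)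
  have "bij_betw g (V - X) {..<b}"
    using bY gV by (subst bij_betw_cong[where g = h]) auto
  from bij_betw_combine[OF this gE]
  have gY': "bij_betw g (V - X \<union> Ev) {..<b + (m + 1) div 2}"
    by (simp add: ivl_disj_un ivl_disj_int)
  have setp: "set p = Od \<union> Ev" unfolding Od_def Ev_def m_def set_conv_nth by blast
  have "Od \<inter> Ev = {}" unfolding Od_def Ev_def using p(1) m_def
    by (auto simp: nth_eq_iff_index_eq)
  then have Y': "V \<union> set p - (X \<union> Od) = V - X \<union> Ev"
    using X p(3) setp by blast
  have halves: "(m + 1) div 2 + m div 2 = m" by presburger
  \<comment> \<open>The number of edges, in the form that \<open>card E + 1 = a + b\<close> takes
    for the enlarged classes.\<close>
  define N where "N = u + (v + m div 2) + (b + (m + 1) div 2)"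
  have N: "N = u + v + b + m" using halves N_def by linarith
  have odd_in: "p ! i \<in> X \<union> Od" if "i < m" "odd i" for i using that by (auto simp: Od_def)
  have even_in: "p ! i \<in> V - X \<union> Ev" if "i < m" "even i" for i using that by (auto simp: Ev_def)
  have gc: "g c = u" using X c gV by auto
  \<comment> \<open>The old edges use exactly the sums below \<open>u + v + b\<close>; the start
    \<open>w 0 = v\<close> makes the linking edge take the next value, and the edges of
    \<open>p\<close> follow from \<open>u + v + b + 1\<close> on.\<close>
  have link: "g c + g (p ! 0) = u + v + b" using gp[OF m0] gc w(2) by simp
  have gsum: "g (p ! i) + g (p ! Suc i) = u + v + b + 1 + (w i + w (Suc i))" if "Suc i < m" for i
    using gp[of i] gp[of "Suc i"] that by (simp add: a_def)
  have wsum: "w i + w (Suc i) < m - 1" if "Suc i < m" for i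
    using w(1) that unfolding alpha_path_def by blast
  have wonto: "\<exists>i. Suc i < m \<and> w i + w (Suc i) = k" if "k < m - 1" for k
    using w(1) that unfolding alpha_path_def by blast
  have pair: "\<exists>x\<in>X \<union> Od. \<exists>y\<in>V - X \<union> Ev. {p ! i, p ! Suc i} = {x, y} \<and>
      g x + g y = u + v + b + 1 + (w i + w (Suc i))" if "Suc i < m" for i
  proof (cases "even i")
    case True
    then show ?thesis using that odd_in[of "Suc i"] even_in[of i] gsum[OF that]
      by (intro bexI[of _ "p ! Suc i"] bexI[of _ "p ! i"]) auto
  next
    case False
    then show ?thesis using that odd_in[of i] even_in[of "Suc i"] gsum[OF that]
      by (intro bexI[of _ "p ! i"] bexI[of _ "p ! Suc i"]) auto
  qed
  have pe: "path_edges (c # p) = insert {c, p ! 0} {{p ! i, p ! Suc i} | i. Suc i < m}"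
    using m0 unfolding path_edges_def m_def[symmetric]
    by (auto simp: m_def nth_Cons gr0_conv_Suc split: nat.splits) 
  have cp: "distinct (c # p)" using p X c by auto
  \<comment> \<open>Every new edge contains a vertex of \<open>p\<close>, which lies outside
    \<open>V\<close>.\<close>
  have disj: "E \<inter> path_edges (c # p) = {}"
    using EV notV m0 unfolding pe by fastforce
  have "card (E \<union> path_edges (c # p)) = N"
    using card_Un_disjoint[OF E(1) card_path_edges(1)[OF cp] disj] card_path_edges(2)[OF cp] E(2) N
    by (simp add: m_def)
  moreover have "\<exists>x\<in>X \<union> Od. \<exists>y\<in>V - X \<union> Ev. e = {x, y} \<and> g x + g y < N"
    if e: "e \<in> E \<union> path_edges (c # p)" for e
  proof -
    consider "e \<in> E" | "e = {c, p ! 0}" | i where "Suc i < m" "e = {p ! i, p ! Suc i}"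
      using e unfolding pe by blast
    then show ?thesis
    proof cases
      case 1
      then obtain x y where "x \<in> X" "y \<in> V - X" "e = {x, y}" "h x + h y < u + v + b"
        using edge by blast
      then show ?thesis using gV[of x] gV[of y] X N
        by (intro bexI[of _ x] bexI[of _ y]) auto
    next
      case 2
      then show ?thesis using link N m0 c even_in[of 0]
        by (intro bexI[of _ c] bexI[of _ "p ! 0"]) auto
    next
      case 3
      then obtain x y where "x \<in> X \<union> Od" "y \<in> V - X \<union> Ev" "e = {x, y}"
        "g x + g y = u + v + b + 1 + (w i + w (Suc i))" using pair by metis
      moreover from this wsum[OF 3(1)] N have "g x + g y < N" by linarith
      ultimately show ?thesis by blast
    qed
  qed
  moreover have "\<exists>x\<in>X \<union> Od. \<exists>y\<in>V - X \<union> Ev. {x, y} \<in> E \<union> path_edges (c # p) \<and> g x + g y = k"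
    if "k < N" for k
  proof -
    consider "k < u + v + b" | "k = u + v + b" | "u + v + b + 1 \<le> k" by linarith
    then show ?thesis
    proof cases
      case 1
      then obtain x y where "x \<in> X" "y \<in> V - X" "{x, y} \<in> E" "h x + h y = k"
        using onto by blast
      then show ?thesis using gV[of x] gV[of y] X
        by (intro bexI[of _ x] bexI[of _ y]) auto
    next
      case 2
      then show ?thesis using link m0 c even_in[of 0] pe
        by (intro bexI[of _ c] bexI[of _ "p ! 0"]) auto
    next
      case 3
      with that N have "k - (u + v + b + 1) < m - 1" by linarith
      then obtain i where i: "Suc i < m" "w i + w (Suc i) = k - (u + v + b + 1)"
        using wonto by blast
      then obtain x y where "x \<in> X \<union> Od" "y \<in> V - X \<union> Ev" "{p ! i, p ! Suc i} = {x, y}"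
        "g x + g y = u + v + b + 1 + (w i + w (Suc i))" using pair by metis
      moreover have "{p ! i, p ! Suc i} \<in> path_edges (c # p)" using i pe by blast
      ultimately show ?thesis using i(2) 3 by (metis UnI2 le_add_diff_inverse)
    qed
  qed
  moreover have "X \<union> Od \<subseteq> V \<union> set p" using X setp by blast
  moreover have "bij_betw g (X \<union> Od) {..<u + (v + m div 2) + 1}" using gX' by (simp add: a_def add.assoc)
  ultimately show ?thesis
    unfolding alpha_labeled_def alpha_labeling_def m_def[symmetric]
    using UnI1[OF c(1)] gc gY' E(1) card_path_edges(1)[OF cp]
    by (intro exI[of _ "X \<union> Od"] exI[of _ g] exI[of _ "b + (m + 1) div 2"])
       (simp add: Y' N_def del: Un_iff)
qed

section \<open>Decomposition of a tree into legs\<close>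

lemma is_path_nth:
  "is_path V E p \<longleftrightarrow>
     p \<noteq> [] \<and> set p \<subseteq> V \<and> distinct p \<and> (\<forall>i. Suc i < length p \<longrightarrow> {p ! i, p ! Suc i} \<in> E)"
  unfolding is_path_def successively_conv_nth by blast

lemma is_path_snoc:
  assumes "is_path V E q" and "{last q, y} \<in> E" and "y \<in> V" and "y \<notin> set q"
  shows "is_path V E (q @ [y])"
  using assms unfolding is_path_def by (auto simp: successively_append_iff)

lemma path_edges_snoc_mono: "path_edges p \<subseteq> path_edges (p @ [y])"
  unfolding path_edges_def by (force simp: nth_append)

lemma path_edges_subset: "is_path V E p \<Longrightarrow> path_edges p \<subseteq> E"
  unfolding is_path_nth path_edges_def by blast

lemma in_path_edges_subset: "e \<in> path_edges p \<Longrightarrow> e \<subseteq> set p"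
  unfolding path_edges_def by auto

text \<open>Otherwise the segment from \<open>p ! i\<close> to \<open>p ! j\<close> has at least
  three vertices and the chord closes it to a cycle.\<close>

lemma is_path_chord:
  assumes "is_tree V E" and p: "is_path V E p" and ij: "i < j" "j < length p"
    and chord: "{p ! i, p ! j} \<in> E"
  shows "j = Suc i"
proof (rule ccontr)
  assume "j \<noteq> Suc i"
  define r where "r = drop i (take (Suc j) p)"
  have len: "length r = Suc j - i" unfolding r_def using ij by simp
  have nth: "r ! k = p ! (i + k)" if "k < length r" for k
    using that ij unfolding r_def by simp
  have "r \<noteq> []" "set r \<subseteq> V" "distinct r"
    using p ij unfolding r_def is_path_def by (auto dest!: in_set_dropD in_set_takeD)
  moreover have "{r ! k, r ! Suc k} \<in> E" if "Suc k < length r" for k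
    using that p ij nth[of k] nth[of "Suc k"] len unfolding is_path_nth by simp
  ultimately have "is_path V E r" unfolding is_path_nth by blast
  moreover have "{last r, hd r} \<in> E"
    using chord \<open>r \<noteq> []\<close> len nth[of 0] nth[of "j - i"] ij
    by (simp add: last_conv_nth hd_conv_nth insert_commute Suc_diff_le)
  moreover have "3 \<le> length r" using len ij \<open>j \<noteq> Suc i\<close> by linarith
  ultimately have "is_cycle V E r" unfolding is_cycle_def by blast
  with assms(1) show False unfolding is_tree_def by blast
qed

lemma finite_tree_edges: "is_tree V E \<Longrightarrow> finite E"
  unfolding is_tree_def simple_graph_def
  by (meson PowI finite_Pow_iff finite_subset subsetI)

lemma tree_edgeE:
  assumes "is_tree V E" and "e \<in> E" and "x \<in> e"
  obtains y where "e = {x, y}" and "x \<noteq> y" and "x \<in> V" and "y \<in> V"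
proof -
  have "e \<subseteq> V" "card e = 2" using assms unfolding is_tree_def simple_graph_def by auto
  then show thesis using assms(3) that by (metis card_2_iff doubleton_eq_iff insert_iff insert_subset singletonD)
qed

lemma two_le_vertex_degree:
  assumes "finite E" and "{x, a} \<in> E" and "{x, b} \<in> E" and "a \<noteq> b"
  shows "2 \<le> vertex_degree E x"
proof -
  have "card {{x, a}, {x, b}} = 2" using assms(4) by (auto simp: card_2_iff doubleton_eq_iff)
  moreover have "card {{x, a}, {x, b}} \<le> card {e \<in> E. x \<in> e}"
    using assms by (intro card_mono) auto
  ultimately show ?thesis unfolding vertex_degree_def by simp
qed

lemma three_le_vertex_degree:
  assumes "finite E" and "{x, a} \<in> E" and "{x, b} \<in> E" and "{x, d} \<in> E"
    and "a \<noteq> b" and "a \<noteq> d" and "b \<noteq> d"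
  shows "3 \<le> vertex_degree E x"
proof -
  have "card {{x, a}, {x, b}, {x, d}} = 3" using assms(5-) by (auto simp: doubleton_eq_iff)
  moreover have "card {{x, a}, {x, b}, {x, d}} \<le> card {e \<in> E. x \<in> e}"
    using assms by (intro card_mono) auto
  ultimately show ?thesis unfolding vertex_degree_def by simp
qed

text \<open>
  In contrast to \<open>legs\<close>, the root may have any degree. A path graph is then the case of a root of
  degree at most one.
\<close>

definition rooted_legs :: "'a set \<Rightarrow> 'a set set \<Rightarrow> 'a \<Rightarrow> 'a list set" where
  "rooted_legs V E c = {p. is_path V E p \<and> hd p = c \<and> is_leaf V E (last p) \<and> 2 \<le> length p}"

text \<open>Take a longest path from \<open>c\<close> through \<open>e\<close>. By maximality its
  end has no neighbour off the path, and by \<open>is_path_chord\<close> its only neighbour on the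
  path is its predecessor; so the end is a leaf.\<close>

lemma edge_on_rooted_leg:
  assumes tree: "is_tree V E" and "c \<in> V" and e: "e \<in> E"
  shows "\<exists>p\<in>rooted_legs V E c. e \<in> path_edges p"
proof -
  define P where "P r \<longleftrightarrow> is_path V E r \<and> hd r = c \<and> e \<in> path_edges r" for r
  have "e \<noteq> {}" using tree e unfolding is_tree_def simple_graph_def by fastforce
  then obtain x where "x \<in> e" by blast
  then obtain y where xy: "e = {x, y}" "x \<noteq> y" "x \<in> V" "y \<in> V"
    using tree_edgeE[OF tree e] by metis
  obtain q where q: "is_path V E q" "hd q = c" "last q = x"
    using tree \<open>c \<in> V\<close> \<open>x \<in> V\<close> unfolding is_tree_def connected_graph_def by blast
  have "q \<noteq> []" using q(1) unfolding is_path_def by blast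
  \<comment> \<open>A path from \<open>c\<close> to one end \<open>x\<close> of \<open>e\<close>
    either avoids the other end \<open>y\<close>, which is then appended, or contains
    \<open>y\<close>, which then precedes \<open>x\<close> because \<open>e\<close> would otherwise
    be a chord.\<close>
  have "\<exists>r. P r"
  proof (cases "y \<in> set q")
    case True
    then obtain i where i: "i < length q" "q ! i = y" by (auto simp: in_set_conv_nth)
    have x: "q ! (length q - 1) = x" using q(3) \<open>q \<noteq> []\<close> by (simp add: last_conv_nth)
    with i xy(2) have "i < length q - 1" by (metis One_nat_def Suc_pred less_SucE length_greater_0_conv \<open>q \<noteq> []\<close>)
    moreover have "{q ! i, q ! (length q - 1)} \<in> E" using e xy(1) x i by (simp add: insert_commute)
    ultimately have "length q - 1 = Suc i"
      using is_path_chord[OF tree q(1), of i "length q - 1"] by simp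
    then have "e \<in> path_edges q" unfolding path_edges_def using xy(1) x i(2)
      by (auto intro!: exI[of _ i])
    then show ?thesis using q unfolding P_def by blast
  next
    case False
    have "is_path V E (q @ [y])" using is_path_snoc[OF q(1)] q(3) xy e False by simp
    moreover have "e \<in> path_edges (q @ [y])"
      unfolding path_edges_def using xy(1) q(3) \<open>q \<noteq> []\<close>
      by (auto simp: nth_append last_conv_nth intro!: exI[of _ "length q - 1"])
    ultimately show ?thesis using q(2) \<open>q \<noteq> []\<close> unfolding P_def by (intro exI[of _ "q @ [y]"]) simp
  qed
  moreover have "length r < Suc (card V)" if "P r" for r
  proof -
    have "finite V" using tree unfolding is_tree_def simple_graph_def by blast
    moreover have "distinct r" "set r \<subseteq> V" using that unfolding P_def is_path_def by blast+
    ultimately show ?thesis by (metis card_mono distinct_card less_Suc_eq_le)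
  qed
  ultimately obtain r where r: "P r" and max: "\<And>t. P t \<Longrightarrow> length t \<le> length r"
    using ex_has_greatest_nat[of P _ length "Suc (card V)"] by blast
  define n where "n = length r"
  have path: "is_path V E r" and "r \<noteq> []" using r unfolding P_def is_path_def by blast+
  have n: "2 \<le> n" using r unfolding P_def path_edges_def n_def by fastforce
  have last: "last r = r ! (n - 1)" using \<open>r \<noteq> []\<close> n_def by (simp add: last_conv_nth)
  have "Suc (n - 2) = n - 1" using n by linarith
  then have final: "{r ! (n - 2), r ! (n - 1)} \<in> E"
    using path n unfolding is_path_nth n_def by (metis diff_less length_greater_0_conv zero_less_one)
  have "e' = {r ! (n - 2), r ! (n - 1)}" if e': "e' \<in> E" "last r \<in> e'" for e'
  proof -
    obtain w where w: "e' = {last r, w}" "last r \<noteq> w" "w \<in> V" using tree_edgeE[OF tree e'] by blast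
    have "w \<in> set r"
    proof (rule ccontr)
      assume "w \<notin> set r"
      then have "is_path V E (r @ [w])" using is_path_snoc[OF path] e' w by simp
      then have "P (r @ [w])" using r path_edges_snoc_mono[of r w] \<open>r \<noteq> []\<close> unfolding P_def by auto
      then show False using max[of "r @ [w]"] by simp
    qed
    then obtain i where i: "i < n" "r ! i = w" by (auto simp: in_set_conv_nth n_def)
    then have "i \<noteq> n - 1" using w(2) last by auto
    with i have "i < n - 1" by linarith
    then have i': "n - 1 = Suc i"
      using is_path_chord[OF tree path, of i "n - 1"] e' w(1) i last n_def by (simp add: insert_commute)
    then have "n - 2 = i" by linarith
    then show ?thesis using w(1) i(2) last by (simp add: insert_commute)
  qed
  moreover have "last r \<in> {r ! (n - 2), r ! (n - 1)}" using last by simp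
  ultimately have "{e' \<in> E. last r \<in> e'} = {{r ! (n - 2), r ! (n - 1)}}" using final by blast
  then have "vertex_degree E (last r) = 1" unfolding vertex_degree_def by simp
  moreover have "last r \<in> V" using path \<open>r \<noteq> []\<close> unfolding is_path_def by auto
  ultimately have "r \<in> rooted_legs V E c"
    using r n unfolding rooted_legs_def P_def is_leaf_def n_def by blast
  then show ?thesis using r unfolding P_def by blast
qed

text \<open>Beyond the root the degree is at most two, so two consecutive vertices of a leg
  determine the next one. Moreover \<open>q\<close> cannot stop where \<open>p\<close> continues,
  since its last vertex is a leaf.\<close>

lemma rooted_leg_prefix:
  assumes tree: "is_tree V E" and deg: "\<And>x. x \<in> V \<Longrightarrow> x \<noteq> c \<Longrightarrow> vertex_degree E x \<le> 2"
    and p: "p \<in> rooted_legs V E c" and q: "q \<in> rooted_legs V E c" and same: "p ! 1 = q ! 1"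
  shows "k < length p \<Longrightarrow> k < length q \<and> p ! k = q ! k"
proof (induction k rule: less_induct)
  case (less k)
  have pp: "is_path V E p" "hd p = c" "p \<noteq> []" "2 \<le> length p" "distinct p"
    and qq: "is_path V E q" "hd q = c" "q \<noteq> []" "2 \<le> length q" "distinct q" "vertex_degree E (last q) = 1"
    using p q unfolding rooted_legs_def is_leaf_def is_path_def by auto
  consider "k = 0" | "k = 1" | j where "k = Suc (Suc j)" by (metis One_nat_def not0_implies_Suc)
  then show ?case
  proof cases
    case 1
    then show ?thesis using pp qq by (metis hd_conv_nth length_greater_0_conv)
  next
    case 2
    then show ?thesis using qq same by simp
  next
    case 3
    have j: "j < length q" "p ! j = q ! j" "Suc j < length q" "p ! Suc j = q ! Suc j"
      using less.IH[of j] less.IH[of "Suc j"] less.prems 3 by auto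
    let ?x = "p ! Suc j"
    have "?x \<in> V" using pp(1) less.prems 3 unfolding is_path_def by (meson Suc_lessD nth_mem subsetD)
    moreover have "?x \<noteq> c"
      using pp(2,3,5) less.prems 3 by (auto simp: hd_conv_nth nth_eq_iff_index_eq)
    ultimately have le2: "vertex_degree E ?x \<le> 2" by (rule deg)
    have e1: "{?x, p ! j} \<in> E" and e2: "{?x, p ! k} \<in> E"
      using pp(1) less.prems 3 unfolding is_path_nth by (auto simp: insert_commute)
    have jk: "p ! j \<noteq> p ! k" using pp(5) less.prems 3 by (simp add: nth_eq_iff_index_eq)
    have "k < length q"
    proof (rule ccontr)
      assume "\<not> k < length q"
      with j(3) 3 have "length q = Suc (Suc j)" by linarith
      then have "last q = ?x" using qq(3) j(4) by (simp add: last_conv_nth)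
      then show False using two_le_vertex_degree[OF finite_tree_edges[OF tree] e1 e2 jk] qq(6) by simp
    qed
    then have e3: "{?x, q ! k} \<in> E"
      using qq(1) 3 j unfolding is_path_nth by auto
    have "p ! j \<noteq> q ! k" using j \<open>k < length q\<close> qq(5) 3 by (simp add: nth_eq_iff_index_eq)
    then have "p ! k = q ! k"
      using three_le_vertex_degree[OF finite_tree_edges[OF tree] e1 e2 e3 jk] le2 by linarith
    with \<open>k < length q\<close> show ?thesis by blast
  qed
qed

lemma rooted_leg_eqI:
  assumes "is_tree V E" and "\<And>x. x \<in> V \<Longrightarrow> x \<noteq> c \<Longrightarrow> vertex_degree E x \<le> 2"
    and "p \<in> rooted_legs V E c" and "q \<in> rooted_legs V E c" and "p ! 1 = q ! 1"
  shows "p = q"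
proof -
  note pq = rooted_leg_prefix[OF assms(1,2,3,4,5)] and qp = rooted_leg_prefix[OF assms(1,2,4,3) assms(5)[symmetric]]
  have "length p = length q"
    using pq[of "length q"] qp[of "length p"] by (meson linorder_neqE_nat less_irrefl)
  then show ?thesis using pq by (intro nth_equalityI) auto
qed

text \<open>The first vertex of \<open>tl p\<close> on \<open>tl q\<close> must be a neighbour of
  \<open>c\<close>: otherwise \<open>p\<close> enters it from outside \<open>q\<close>, giving it
  degree at least three, or at least two if it is the leaf of \<open>q\<close>. Thus both legs start
  with the same edge.\<close>

lemma rooted_legs_disjoint:
  assumes tree: "is_tree V E" and deg: "\<And>x. x \<in> V \<Longrightarrow> x \<noteq> c \<Longrightarrow> vertex_degree E x \<le> 2"
    and p: "p \<in> rooted_legs V E c" and q: "q \<in> rooted_legs V E c"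
    and meet: "set (tl p) \<inter> set (tl q) \<noteq> {}"
  shows "p = q"
proof (rule rooted_leg_eqI[OF tree deg p q])
  have pp: "is_path V E p" "hd p = c" "p \<noteq> []" "2 \<le> length p" "distinct p"
    and qq: "is_path V E q" "hd q = c" "q \<noteq> []" "2 \<le> length q" "distinct q" "vertex_degree E (last q) = 1"
    using p q unfolding rooted_legs_def is_leaf_def is_path_def by auto
  have p0: "p ! 0 = c" and q0: "q ! 0 = c" using pp qq by (simp_all add: hd_conv_nth[symmetric])
  define M where "M i \<longleftrightarrow> Suc i < length p \<and> p ! Suc i \<in> set (tl q)" for i
  obtain x where "x \<in> set (tl p)" "x \<in> set (tl q)" using meet by blast
  then obtain i0 where "M i0"
    by (auto simp: in_set_conv_nth[of x "tl p"] nth_tl M_def less_diff_conv)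
  define i where "i = (LEAST i. M i)"
  have i: "M i" and least: "\<And>j. j < i \<Longrightarrow> \<not> M j"
    using LeastI[of M, OF \<open>M i0\<close>] not_less_Least[of _ M] unfolding i_def by blast+
  then obtain j where j: "Suc j < length q" "p ! Suc i = q ! Suc j"
    unfolding M_def by (fastforce simp: in_set_conv_nth nth_tl less_diff_conv)
  let ?x = "p ! Suc i"
  have si: "Suc i < length p" using i M_def by blast
  have e1: "{?x, p ! i} \<in> E" using pp(1) si unfolding is_path_nth by (auto simp: insert_commute)
  have e2: "{?x, q ! j} \<in> E" using qq(1) j unfolding is_path_nth by (auto simp: insert_commute)
  have "i = 0"
  proof (rule ccontr)
    assume "i \<noteq> 0"
    then obtain i' where i': "i = Suc i'" by (cases i) auto
    have out: "p ! i \<notin> set (tl q)" using least[of i'] i' si unfolding M_def by simp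
    moreover have "p ! i \<noteq> c" using pp(3,5) p0 si i' by (auto simp: nth_eq_iff_index_eq)
    moreover have "set q = insert c (set (tl q))" using qq(2,3) by (cases q) auto
    ultimately have out': "p ! i \<notin> set q" by simp
    then have ne: "p ! i \<noteq> q ! j" using j by auto
    have "?x \<in> V" using pp(1) si unfolding is_path_def by (meson nth_mem subsetD)
    moreover have "?x \<noteq> c" using pp(3,5) p0 si by (auto simp: nth_eq_iff_index_eq)
    ultimately have le2: "vertex_degree E ?x \<le> 2" by (rule deg)
    show False
    proof (cases "Suc (Suc j) < length q")
      case True
      then have e3: "{?x, q ! Suc (Suc j)} \<in> E" using qq(1) j unfolding is_path_nth by simp
      have "q ! j \<noteq> q ! Suc (Suc j)" using qq(5) True by (simp add: nth_eq_iff_index_eq)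
      moreover have "p ! i \<noteq> q ! Suc (Suc j)" using out' True by auto
      ultimately show False
        using three_le_vertex_degree[OF finite_tree_edges[OF tree] e1 e2 e3 ne] le2 by simp
    next
      case False
      then have "length q = Suc (Suc j)" using j by linarith
      then have "last q = ?x" using j qq(3) by (simp add: last_conv_nth)
      then show False using two_le_vertex_degree[OF finite_tree_edges[OF tree] e1 e2 ne] qq(6) by simp
    qed
  qed
  \<comment> \<open>The meeting vertex is adjacent to the root of \<open>q\<close>, so it is the
    second vertex of \<open>q\<close>, as a chord is impossible.\<close>
  then have "{q ! 0, q ! Suc j} \<in> E" using e1 p0 q0 j by (simp add: insert_commute)
  then have "Suc j = Suc 0" using is_path_chord[OF tree qq(1)] j by blast
  then show "p ! 1 = q ! 1" using j \<open>i = 0\<close> by simp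
qed (use deg in auto)

text \<open>A vertex other than \<open>c\<close> is covered through the last edge of a path from
  \<open>c\<close> to it. The explicit \<open>insert c\<close> accounts for the one-vertex tree,
  which has no rooted leg.\<close>

lemma tree_eq_rooted_legs:
  assumes tree: "is_tree V E" and c: "c \<in> V"
  shows "E = (\<Union>p\<in>rooted_legs V E c. path_edges p)" and "V = insert c (\<Union>p\<in>rooted_legs V E c. set p)"
proof -
  have path: "is_path V E p" if "p \<in> rooted_legs V E c" for p
    using that unfolding rooted_legs_def by blast
  show E: "E = (\<Union>p\<in>rooted_legs V E c. path_edges p)"
    using edge_on_rooted_leg[OF tree c] path_edges_subset[OF path] by blast
  have "v \<in> (\<Union>p\<in>rooted_legs V E c. set p)" if v: "v \<in> V" "v \<noteq> c" for v
  proof -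
    obtain q where q: "is_path V E q" "hd q = c" "last q = v"
      using tree c v unfolding is_tree_def connected_graph_def by blast
    then obtain t where t: "q = c # t" "t \<noteq> []"
      using v(2) unfolding is_path_def by (cases q) (auto split: if_splits)
    have "Suc (length q - 2) < length q" "Suc (length q - 2) = length q - 1"
      using t by (cases t; simp)+
    then have "{q ! (length q - 2), v} \<in> E"
      using q(1) q(3) t unfolding is_path_nth by (metis last_conv_nth)
    then obtain p where "p \<in> rooted_legs V E c" "{q ! (length q - 2), v} \<in> path_edges p"
      using E by blast
    moreover from this(2) have "v \<in> set p" using in_path_edges_subset by (metis insert_subset)
    ultimately show ?thesis by blast
  qed
  then show "V = insert c (\<Union>p\<in>rooted_legs V E c. set p)"
    using c path unfolding is_path_def by auto
qed

section \<open>Spiders\<close>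

text \<open>Starting from the root alone, the legs are attached in the order of \<open>L\<close>;
  before each attachment the labeling may be swapped to avoid the exceptional start of the new
  path.\<close>

lemma graceful_if_legs_double:
  assumes tree: "is_tree V E" and c: "c \<in> V"
    and deg: "\<And>x. x \<in> V \<Longrightarrow> x \<noteq> c \<Longrightarrow> vertex_degree E x \<le> 2"
    and L: "bij_betw L {1..s} (rooted_legs V E c)"
    and growth: "\<And>i. 1 \<le> i \<Longrightarrow> i < s \<Longrightarrow>
      2 * card (path_edges (L i)) + 2 \<le> card (path_edges (L (Suc i)))"
  shows "graceful V E"
proof -
  define l where "l i = card (path_edges (L i))" for i
  define W where "W k = insert c (\<Union>i\<in>{1..k}. set (L i))" for k
  define F where "F k = (\<Union>i\<in>{1..k}. path_edges (L i))" for k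
  have leg: "L i \<in> rooted_legs V E c" if "1 \<le> i" "i \<le> s" for i
    using bij_betwE[OF L] that by auto
  have shape: "distinct (L i)" "L i = c # tl (L i)" "tl (L i) \<noteq> []" "length (tl (L i)) = l i"
    if "1 \<le> i" "i \<le> s" for i
  proof -
    have "is_path V E (L i)" "hd (L i) = c" "2 \<le> length (L i)"
      using leg[OF that] unfolding rooted_legs_def by blast+
    then show "distinct (L i)" "L i = c # tl (L i)" "tl (L i) \<noteq> []" "length (tl (L i)) = l i"
      using card_path_edges(2)[of "L i"] unfolding is_path_def l_def
      by (cases "L i"; auto)+
  qed
  \<comment> \<open>The invariant bounds \<open>u + v\<close> by the latest leg length. The case
    \<open>k = 0\<close> is separate because \<open>L 0\<close> is not a leg and \<open>l 0\<close>
    carries no information.\<close>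
  have "\<exists>u v. alpha_labeled (W k) (F k) c u v \<and> (if k = 0 then u = 0 \<and> v = 0 else u + v < l k)"
    if "k \<le> s" for k
    using that
  proof (induction k)
    case 0
    then show ?case using alpha_labeled_singleton[of c] by (auto simp: W_def F_def)
  next
    case (Suc k)
    then obtain u v where lab: "alpha_labeled (W k) (F k) c u v"
      and uv: "if k = 0 then u = 0 \<and> v = 0 else u + v < l k" by auto
    define p where "p = tl (L (Suc k))"
    have p: "L (Suc k) = c # p" "p \<noteq> []" "length p = l (Suc k)" "distinct (c # p)"
      using shape[of "Suc k"] Suc.prems unfolding p_def by auto
    have "set p \<inter> set (L i) = {}" if "1 \<le> i" "i \<le> k" for i
    proof -
      have "L i \<noteq> L (Suc k)"
        using bij_betw_imp_inj_on[OF L] that Suc.prems by (auto dest: inj_onD)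
      then have "set (tl (L (Suc k))) \<inter> set (tl (L i)) = {}"
        using rooted_legs_disjoint[OF tree deg leg[of "Suc k"] leg[of i]] that Suc.prems by fastforce
      moreover have "set (L i) = insert c (set (tl (L i)))"
        using shape(2)[of i] that Suc.prems by (metis list.simps(15) order_trans Suc_leD)
      ultimately show ?thesis using p(4) p_def by auto
    qed
    then have disj: "set p \<inter> W k = {}" using p(4) unfolding W_def by fastforce
    have FW: "e \<subseteq> W k" if "e \<in> F k" for e
      using that in_path_edges_subset unfolding F_def W_def by fastforce
    have WF: "W (Suc k) = W k \<union> set p" "F (Suc k) = F k \<union> path_edges (c # p)"
      unfolding W_def F_def using p(1) by (auto simp: atLeastAtMostSuc_conv)
    \<comment> \<open>For \<open>k > 0\<close>, \<open>u + v + 1 \<le> l k\<close> gives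
      \<open>2 * (u + v) + 4 \<le> 2 * l k + 2\<close>; for \<open>k = 0\<close> only the root is
      present.\<close>
    have big: "2 * (u + v) + 4 \<le> l (Suc k) \<or> u + v = 0 \<and> 1 \<le> l (Suc k)"
      using uv growth[of k] Suc.prems p(2,3) unfolding l_def[symmetric]
      by (cases "k = 0") (auto simp: Suc_le_eq)
    \<comment> \<open>Stated for arbitrary \<open>x\<close> and \<open>y\<close> with the same sum,
      so that it applies to \<open>u, v\<close> and to the swapped pair \<open>v, u\<close>.\<close>
    have attach: "\<exists>u v. alpha_labeled (W (Suc k)) (F (Suc k)) c u v \<and>
          (if Suc k = 0 then u = 0 \<and> v = 0 else u + v < l (Suc k))"
      if "alpha_labeled (W k) (F k) c x y" "x + y = u + v" "y = 0 \<or> l (Suc k) \<noteq> 4 * y + 1" for x y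
    proof -
      have "y < (length p + 1) div 2" using big that(2) p(3) by (elim disjE) auto
      then have "alpha_labeled (W (Suc k)) (F (Suc k)) c x (y + length p div 2)"
        unfolding WF using that p disj FW by (intro alpha_labeled_attach_path) auto
      moreover have "x + (y + length p div 2) < l (Suc k)" using big that(2) p(3) by (elim disjE) auto
      ultimately show ?thesis by auto
    qed
    show ?case
    proof (cases "v = 0 \<or> l (Suc k) \<noteq> 4 * v + 1")
      case True
      then show ?thesis using attach[OF lab] by blast
    next
      case False
      \<comment> \<open>If \<open>u\<close> and \<open>v\<close> were both positive and exceptional,
        then \<open>2 * (u + v) = l (Suc k) - 1\<close>, against \<open>big\<close>.\<close>
      then have "u = 0 \<or> l (Suc k) \<noteq> 4 * u + 1" using big by (elim disjE) auto
      then show ?thesis using attach[OF alpha_labeled_swap[OF lab]] by (simp add: add.commute)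
    qed
  qed
  then obtain u v where "alpha_labeled (W s) (F s) c u v" by blast
  moreover have "W s = insert c (\<Union>p\<in>rooted_legs V E c. set p)"
    "F s = (\<Union>p\<in>rooted_legs V E c. path_edges p)"
    unfolding W_def F_def bij_betw_imp_surj_on[OF L, symmetric] by simp_all
  then have "W s = V" "F s = E" using tree_eq_rooted_legs[OF tree c] by simp_all
  ultimately show ?thesis using alpha_labeled_imp_graceful by metis
qed

text \<open>Rooted at a vertex of degree at most one, the tree has at most one rooted leg, and the
  growth condition becomes vacuous.\<close>

lemma graceful_path_graph:
  assumes tree: "is_tree V E" and deg: "\<And>x. x \<in> V \<Longrightarrow> vertex_degree E x \<le> 2"
  shows "graceful V E"
proof -
  have "V \<noteq> {}" using tree unfolding is_tree_def connected_graph_def by blast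
  then obtain c0 where c0: "c0 \<in> V" by blast
  have "\<exists>c\<in>V. vertex_degree E c \<le> 1"
  proof (cases "E = {}")
    case True
    then show ?thesis using c0 by (auto simp: vertex_degree_def)
  next
    case False
    then obtain p where "p \<in> rooted_legs V E c0" using edge_on_rooted_leg[OF tree c0] by blast
    \<comment> \<open>The far end of any rooted leg is a leaf and serves as the new root.\<close>
    then show ?thesis unfolding rooted_legs_def is_leaf_def by (auto intro!: bexI[of _ "last p"])
  qed
  then obtain c where c: "c \<in> V" "vertex_degree E c \<le> 1" by blast
  have unique: "p = q" if pq: "p \<in> rooted_legs V E c" "q \<in> rooted_legs V E c" for p q
  proof (rule rooted_leg_eqI[OF tree deg pq])
    have "{c, r ! 1} \<in> E" if r: "r \<in> rooted_legs V E c" for r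
    proof -
      have "is_path V E r" "hd r = c" "2 \<le> length r" using r unfolding rooted_legs_def by blast+
      then show ?thesis unfolding is_path_nth by (auto simp: hd_conv_nth dest!: spec[of _ 0])
    qed
    then show "p ! 1 = q ! 1"
      using two_le_vertex_degree[OF finite_tree_edges[OF tree], of c "p ! 1" "q ! 1"] pq c(2) by fastforce
  qed
  have "\<exists>L s. s \<le> 1 \<and> bij_betw L {1..s::nat} (rooted_legs V E c)"
  proof (cases "rooted_legs V E c = {}")
    case True
    then show ?thesis by (intro exI[of _ undefined] exI[of _ 0]) (auto simp: bij_betw_def)
  next
    case False
    then obtain p where "rooted_legs V E c = {p}" using unique by blast
    then show ?thesis by (intro exI[of _ "\<lambda>_. p"] exI[of _ 1]) (auto simp: bij_betw_def)
  qed
  then obtain L and s :: nat where "s \<le> 1" "bij_betw L {1..s} (rooted_legs V E c)" by blast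
  then show ?thesis using deg by (intro graceful_if_legs_double[OF tree c(1)]) auto
qed

theorem theorem1p4:
  fixes V :: "'a set" and E :: "'a set set"
    and s :: nat and L :: "nat \<Rightarrow> 'a list" and l :: "nat \<Rightarrow> nat"
  assumes "spider V E"
    and "bij_betw L {1..s} (legs V E)"
    and "\<And>i. i \<in> {1..s} \<Longrightarrow> l i = card (path_edges (L i))"
    and "\<And>i. i \<in> {2..s - 1} \<Longrightarrow> l (i + 1) \<ge> 2 * l i + 2"
    and "s \<ge> 2 \<Longrightarrow> l 2 mod 4 \<noteq> 1 \<Longrightarrow> l 2 \<ge> 2 * l 1 + 2"
    and "s \<ge> 2 \<Longrightarrow> l 2 mod 4 = 1 \<Longrightarrow> l 2 \<ge> 2 * l 1 + 4"
  shows "graceful V E"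
proof -
  have tree: "is_tree V E"
    and unique: "\<And>x y. x \<in> V \<Longrightarrow> y \<in> V \<Longrightarrow> 2 < vertex_degree E x \<Longrightarrow> 2 < vertex_degree E y \<Longrightarrow> x = y"
    using assms(1) unfolding spider_def by auto
  show ?thesis
  proof (cases "\<exists>c. is_center V E c")
    case False
    then show ?thesis by (intro graceful_path_graph[OF tree]) (auto simp: is_center_def not_less)
  next
    case True
    then obtain c where c: "c \<in> V" "2 < vertex_degree E c" unfolding is_center_def by blast
    have center: "is_center V E x \<longleftrightarrow> x = c" for x using c unique unfolding is_center_def by blast
    \<comment> \<open>A one-vertex path would make the center a leaf; hence \<open>legs\<close> and
      \<open>rooted_legs\<close> agree.\<close>
    have "2 \<le> length p" if "is_path V E p" "hd p = c" "is_leaf V E (last p)" for p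
    proof (rule ccontr)
      assume "\<not> 2 \<le> length p"
      moreover have "p \<noteq> []" using that(1) unfolding is_path_def by blast
      ultimately have "last p = c" using that(2) by (cases p) (auto simp: not_le)
      with that c show False unfolding is_leaf_def by simp
    qed
    then have legs: "legs V E = rooted_legs V E c"
      unfolding legs_def rooted_legs_def center by blast
    have "2 * card (path_edges (L i)) + 2 \<le> card (path_edges (L (Suc i)))" if i: "1 \<le> i" "i < s" for i
    proof (cases "i = 1")
      case True
      then have "2 * l 1 + 2 \<le> l 2" using assms(5,6) i by linarith
      then show ?thesis using assms(3)[of 1] assms(3)[of 2] i True by (simp add: numeral_2_eq_2)
    next
      case False
      then show ?thesis using assms(3)[of i] assms(3)[of "Suc i"] assms(4)[of i] i by simp
    qed
    moreover have "vertex_degree E x \<le> 2" if "x \<in> V" "x \<noteq> c" for x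
      using unique[OF that(1) c(1)] c(2) that(2) by (meson not_less)
    ultimately show ?thesis
      using assms(2) unfolding legs by (intro graceful_if_legs_double[OF tree c(1)]) auto
  qed
qed

end
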